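(* Let $\mathcal C:=\mathcal X_1\times\Theta$, and suppose: (i) $\mathcal C$ is nonempty and convex, with finite affine dimension $p=\operatorname{affdim}(\mathcal C)$; (ii) the objective $c^\top x_1+\phi_0(\theta)$ is convex on $\mathcal C$ and the full master problem has a finite optimal value; (iii) for every $s\in\mathcal S$ and $\ell\in[L]$ the set $$\mathcal C_{s,\ell}=\{(x_1,\theta)\in\mathcal C:\ \phi_\ell(\theta,\xi)\ge d(\xi,x_1)^\top s,\ \forall \xi\in\Xi\}$$ is convex. Then there exists a subset $\mathcal S_{\mathrm{obj}}\subseteq\mathcal S$ with $|\mathcal S_{\mathrm{obj}}|\le p$ such that the restricted master $$\min_{(x_1,\theta)\in\mathcal C}\ c^\top x_1+\phi_0(\theta)\quad\text{s.t.}\quad \phi_\ell(\theta,\xi)\ge d(\xi,x_1)^\top s,\quad\forall\xi\in\Xi,\ s\in\mathcal S_{\mathrm{obj}},\ \ell\in[L],$$ has the same optimal objective value as the full master problem (the same problem with $\mathcal S_{\mathrm{obj}}$ replaced by $\mathcal S$).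
   Context: Setting. $\Xi\subseteq\mathbb R^{N_\xi}$ is a compact uncertainty set, $C\in\mathbb R^{M\times N_2}$ with $M\ge N_2$, $b\in\mathbb R^{N_2}$, and $B,W,w,A,a,c$ are fixed data of compatible dimensions; $x_1\in\mathbb R^{N_1}$. Put $d(\xi,x_1)=W\xi+w-Bx_1\in\mathbb R^M$. The dual polyhedron $\mathcal Z=\{z\in\mathbb R^M\mid C^\top z=b,\ z\ge 0\}$ is assumed nonempty; $\mathcal S$ is its finite set of extreme points, and $\mathcal R$ is the finite set of extreme rays of its recession cone $\{r\mid C^\top r=0,\ r\ge0\}$. The first-stage feasible region is $$\mathcal X_1=\{x_1: Ax_1\ge a,\ \sup_{\xi\in\Xi}d(\xi,x_1)^\top r\le 0\ \ \forall r\in\mathcal R\}.$$ $\Theta\subseteq\mathbb R^{N_\theta}$, $\phi_0:\Theta\to\mathbb R$ and $\phi_\ell:\Theta\times\Xi\to\mathbb R$ ($\ell\in[L]$) are given. The full master problem is $$\min_{x_1,\theta}\ c^\top x_1+\phi_0(\theta)\quad\text{s.t.}\quad \phi_\ell(\theta,\xi)\ge d(\xi,x_1)^\top s\ \ \forall\xi\in\Xi,\ s\in\mathcal S,\ \ell\in[L],\quad x_1\in\mathcal X_1,\ \theta\in\Theta.$$ It is assumed throughout to have a finite optimal value and to attain it. Optimal values are understood as infima. $\operatorname{affdim}$ denotes the dimension of the affine hull. *)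

theory Defs
  imports "HOL-Analysis.Analysis"
begin

definition rhs :: "real ^ 'xi ^ 'm \<Rightarrow> real ^ 'm \<Rightarrow> real ^ 'n1 ^ 'm \<Rightarrow> real ^ 'xi \<Rightarrow> real ^ 'n1 \<Rightarrow> real ^ 'm"
  where "rhs W w B \<xi> x = W *v \<xi> + w - B *v x"

definition dual_polyhedron :: "real ^ 'n2 ^ 'm \<Rightarrow> real ^ 'n2 \<Rightarrow> (real ^ 'm) set"
  where "dual_polyhedron C b = {z. transpose C *v z = b \<and> 0 \<le> z}"

definition dual_vertices :: "real ^ 'n2 ^ 'm \<Rightarrow> real ^ 'n2 \<Rightarrow> (real ^ 'm) set"
  where "dual_vertices C b = {s. s extreme_point_of dual_polyhedron C b}"

definition dual_recession_cone :: "real ^ 'n2 ^ 'm \<Rightarrow> (real ^ 'm) set"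
  where "dual_recession_cone C = {r. transpose C *v r = 0 \<and> 0 \<le> r}"

definition ray :: "'a::real_vector \<Rightarrow> 'a set"
  where "ray r = {t *\<^sub>R r | t. 0 \<le> t}"

text \<open>The extreme rays of a pointed polyhedral cone are its one-dimensional faces. A set of
  vectors lists them if it contains exactly one generator of each; the scaling of the generators
  is left open. The zero vector is excluded, since its ray has dimension 0.\<close>
definition lists_extreme_rays :: "'a::euclidean_space set \<Rightarrow> 'a set \<Rightarrow> bool"
  where "lists_extreme_rays R K \<longleftrightarrow> bij_betw ray R {e. e edge_of K}"

text \<open>The supremum is taken in the extended reals, so that it needs no side condition on the
  uncertainty set.\<close>
definition first_stage ::
  "real ^ 'xi ^ 'm \<Rightarrow> real ^ 'm \<Rightarrow> real ^ 'n1 ^ 'm \<Rightarrow> real ^ 'n1 ^ 'k \<Rightarrow> real ^ 'k \<Rightarrow>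
   (real ^ 'xi) set \<Rightarrow> (real ^ 'm) set \<Rightarrow> (real ^ 'n1) set"
  where "first_stage W w B A a \<Xi> R =
    {x. a \<le> A *v x \<and> (\<forall>r\<in>R. (SUP \<xi>\<in>\<Xi>. ereal (rhs W w B \<xi> x \<bullet> r)) \<le> 0)}"

definition objective :: "real ^ 'n1 \<Rightarrow> (real ^ 'th \<Rightarrow> real) \<Rightarrow> (real ^ 'n1) \<times> (real ^ 'th) \<Rightarrow> real"
  where "objective c \<phi>0 = (\<lambda>(x, \<theta>). c \<bullet> x + \<phi>0 \<theta>)"

definition cut_set ::
  "real ^ 'xi ^ 'm \<Rightarrow> real ^ 'm \<Rightarrow> real ^ 'n1 ^ 'm \<Rightarrow> (real ^ 'xi) set \<Rightarrow>
   (nat \<Rightarrow> real ^ 'th \<Rightarrow> real ^ 'xi \<Rightarrow> real) \<Rightarrow> ((real ^ 'n1) \<times> (real ^ 'th)) set \<Rightarrow>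
   real ^ 'm \<Rightarrow> nat \<Rightarrow> ((real ^ 'n1) \<times> (real ^ 'th)) set"
  where "cut_set W w B \<Xi> \<phi> D s l =
    {(x, \<theta>). (x, \<theta>) \<in> D \<and> (\<forall>\<xi>\<in>\<Xi>. \<phi> l \<theta> \<xi> \<ge> rhs W w B \<xi> x \<bullet> s)}"

definition master_feasible ::
  "real ^ 'xi ^ 'm \<Rightarrow> real ^ 'm \<Rightarrow> real ^ 'n1 ^ 'm \<Rightarrow> (real ^ 'xi) set \<Rightarrow>
   nat \<Rightarrow> (nat \<Rightarrow> real ^ 'th \<Rightarrow> real ^ 'xi \<Rightarrow> real) \<Rightarrow> ((real ^ 'n1) \<times> (real ^ 'th)) set \<Rightarrow>
   (real ^ 'm) set \<Rightarrow> ((real ^ 'n1) \<times> (real ^ 'th)) set"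
  where "master_feasible W w B \<Xi> L \<phi> D T =
    {(x, \<theta>). (x, \<theta>) \<in> D \<and>
       (\<forall>\<xi>\<in>\<Xi>. \<forall>s\<in>T. \<forall>l\<in>{1..L}. \<phi> l \<theta> \<xi> \<ge> rhs W w B \<xi> x \<bullet> s)}"

text \<open>Extended-real infimum: \<open>\<infinity>\<close> for an infeasible problem, \<open>-\<infinity>\<close> for an unbounded one.\<close>
definition opt_value :: "('a \<Rightarrow> real) \<Rightarrow> 'a set \<Rightarrow> ereal"
  where "opt_value f F = (INF z\<in>F. ereal (f z))"

end

theory Submission
  imports Defs
begin

text \<open>Helly's theorem carries the proof. The points of \<open>D\<close> at which the objective is strictly
  below the optimal value \<open>v\<close> form a convex set \<open>G\<close>, and those that respect all cuts of one dual
  vertex \<open>s\<close> form a convex set \<open>F s\<close>. Optimality of \<open>v\<close> says that \<open>G\<close> and all the \<open>F s\<close> have no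
  common point. There are finitely many of these sets, since a polyhedron has finitely many extreme
  points, and they all lie in the \<open>p\<close>-dimensional set \<open>D\<close>. So Helly's theorem yields at most
  \<open>p + 1\<close> of them that already have no common point (\<open>Helly_in_aff_dim\<close>). The set \<open>G\<close> must be one
  of these, because any collection of the sets \<open>F s\<close> alone shares the optimal solution. At most
  \<open>p\<close> vertices remain, and their cuts exclude every point with a smaller objective value
  (\<open>convex_program_few_constraints\<close>).\<close>

text \<open>The bound depends on the affine dimension of a common superset and not on that of the ambient
  space. The induction is the usual one on the number of sets. Leaving out one set at a time gives
  points \<open>x i\<close> that lie in every set but possibly the \<open>i\<close>-th. If they are distinct, there are more
  than \<open>d + 1\<close> of them in \<open>D\<close>, so they are affinely dependent and a Radon point of them lies in
  all sets. The family is indexed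
  because distinct constraints may define the same set.\<close>

lemma Helly_in_aff_dim:
  fixes X :: "'i \<Rightarrow> 'a::euclidean_space set"
  assumes "finite I" and "I \<noteq> {}"
    and "\<And>i. i \<in> I \<Longrightarrow> convex (X i)"
    and "\<And>i. i \<in> I \<Longrightarrow> X i \<subseteq> D"
    and "aff_dim D \<le> int d"
    and "\<And>J. J \<subseteq> I \<Longrightarrow> J \<noteq> {} \<Longrightarrow> card J \<le> d + 1 \<Longrightarrow> (\<Inter>i\<in>J. X i) \<noteq> {}"
  shows "(\<Inter>i\<in>I. X i) \<noteq> {}"
  using assms
proof (induction "card I" arbitrary: I rule: less_induct)
  case less
  note fin = less.prems(1) and conv = less.prems(3) and sub = less.prems(4)
  show ?case
  proof (cases "card I \<le> d + 1")
    case True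
    then show ?thesis using less.prems(2,6) by blast
  next
    case False
    have "\<exists>y. \<forall>j\<in>I - {i}. y \<in> X j" if i: "i \<in> I" for i
    proof -
      have smaller: "card (I - {i}) < card I"
        using fin i by (rule card_Diff1_less)
      have nonempty: "I - {i} \<noteq> {}"
      proof
        assume "I - {i} = {}"
        then have "card I \<le> card {i}" by (intro card_mono) auto
        with False show False by simp
      qed
      have "(\<Inter>j\<in>I - {i}. X j) \<noteq> {}"
      proof (rule less.hyps[OF smaller _ nonempty])
        show "(\<Inter>j\<in>J. X j) \<noteq> {}" if "J \<subseteq> I - {i}" "J \<noteq> {}" "card J \<le> d + 1" for J
          using that by (intro less.prems(6)) auto
      qed (use fin conv sub \<open>aff_dim D \<le> int d\<close> in auto)
      then show ?thesis by blast
    qed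
    then obtain x where x: "\<And>i j. i \<in> I \<Longrightarrow> j \<in> I \<Longrightarrow> j \<noteq> i \<Longrightarrow> x i \<in> X j"
      by (metis DiffI singletonD)
    show ?thesis
    proof (cases "inj_on x I")
      case False
      \<comment> \<open>A point chosen for two different indices misses no set at all.\<close>
      then obtain i k where ik: "i \<in> I" "k \<in> I" "i \<noteq> k" "x i = x k"
        by (auto simp: inj_on_def)
      have "x i \<in> X j" if "j \<in> I" for j
        using ik x[of i j] x[of k j] that by (cases "j = i") auto
      then show ?thesis by blast
    next
      case True
      have "x i \<in> D" if i: "i \<in> I" for i
      proof -
        have "\<not> I \<subseteq> {i}"
          using \<open>\<not> card I \<le> d + 1\<close> card_mono[of "{i}" I] by auto
        then obtain j where "j \<in> I" "j \<noteq> i" by blast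
        then show ?thesis using x i sub by blast
      qed
      then have "x ` I \<subseteq> D" by blast
      then have "affine_dependent (x ` I)"
        using independent_card_le_aff_dim[of "x ` I" D] card_image[OF True]
          \<open>\<not> card I \<le> d + 1\<close> \<open>aff_dim D \<le> int d\<close> by linarith
      then obtain M P where MP: "M \<inter> P = {}" "M \<union> P = x ` I" "convex hull M \<inter> convex hull P \<noteq> {}"
        using Radon_partition[of "x ` I"] fin by blast
      then obtain y where y: "y \<in> convex hull M" "y \<in> convex hull P" by blast
      have "y \<in> X i" if i: "i \<in> I" for i
      proof -
        \<comment> \<open>The part that does not contain \<open>x i\<close> lies entirely in \<open>X i\<close>.\<close>
        have in_hull: "convex hull Q \<subseteq> X i" if Q: "Q \<subseteq> x ` I" "x i \<notin> Q" for Q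
        proof (rule hull_minimal)
          show "Q \<subseteq> X i"
          proof
            fix q assume "q \<in> Q"
            then obtain j where "j \<in> I" "q = x j" using Q by blast
            moreover from this have "j \<noteq> i" using \<open>q \<in> Q\<close> Q by blast
            ultimately show "q \<in> X i" using x i by blast
          qed
        qed (use conv i in blast)
        have "x i \<notin> M \<or> x i \<notin> P" using MP by blast
        then show ?thesis using in_hull[of M] in_hull[of P] MP y by blast
      qed
      then show ?thesis by blast
    qed
  qed
qed

text \<open>One of the \<open>d + 1\<close> sets in Helly's theorem is spent on the strict sublevel set of the
  objective, which leaves \<open>d\<close> constraints.\<close>

lemma convex_program_few_constraints:
  fixes f :: "'a::euclidean_space \<Rightarrow> real" and F :: "'i \<Rightarrow> 'a set"
  assumes "finite S"
    and "convex_on D f" and "aff_dim D \<le> int d"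
    and conv: "\<And>s. s \<in> S \<Longrightarrow> convex (F s)"
    and sub: "\<And>s. s \<in> S \<Longrightarrow> F s \<subseteq> D"
    and z: "z \<in> D" "\<And>s. s \<in> S \<Longrightarrow> z \<in> F s"
    and min: "\<And>y. y \<in> D \<Longrightarrow> (\<And>s. s \<in> S \<Longrightarrow> y \<in> F s) \<Longrightarrow> v \<le> f y"
  shows "\<exists>T\<subseteq>S. card T \<le> d \<and> (\<forall>y\<in>D. (\<forall>s\<in>T. y \<in> F s) \<longrightarrow> v \<le> f y)"
proof -
  define G where "G = {y \<in> D. f y < v}"
  define X where "X = case_option G F"
  define I where "I = insert None (Some ` S)"
  have convG: "convex G"
  proof (rule convexI)
    fix x y and a b :: real
    assume xy: "x \<in> G" "y \<in> G" and ab: "0 \<le> a" "0 \<le> b" "a + b = 1"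
    then have "f (a *\<^sub>R x + b *\<^sub>R y) \<le> a * f x + b * f y"
      using \<open>convex_on D f\<close> by (simp add: convex_on_def G_def)
    also have "\<dots> < v"
      using xy ab by (intro convex_bound_lt) (simp_all add: G_def)
    moreover have "a *\<^sub>R x + b *\<^sub>R y \<in> D"
      using \<open>convex_on D f\<close> xy ab by (intro convexD) (simp_all add: convex_on_def G_def)
    ultimately show "a *\<^sub>R x + b *\<^sub>R y \<in> G" by (simp add: G_def)
  qed
  have "(\<Inter>i\<in>I. X i) = {}"
  proof (rule ccontr)
    assume "(\<Inter>i\<in>I. X i) \<noteq> {}"
    then obtain y where "y \<in> G" "\<And>s. s \<in> S \<Longrightarrow> y \<in> F s"
      by (auto simp: I_def X_def)
    then show False using min[of y] by (simp add: G_def)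
  qed
  moreover have "finite I" "I \<noteq> {}"
    using \<open>finite S\<close> by (simp_all add: I_def)
  moreover have "convex (X i)" and "X i \<subseteq> D" if "i \<in> I" for i
    using that conv sub[THEN subsetD] convG by (auto simp: I_def X_def G_def)
  ultimately obtain J where J: "J \<subseteq> I" "J \<noteq> {}" "card J \<le> d + 1" "(\<Inter>i\<in>J. X i) = {}"
    using Helly_in_aff_dim[of I X D d] \<open>aff_dim D \<le> int d\<close> by metis
  have "None \<in> J"
  proof (rule ccontr)
    assume "None \<notin> J"
    then have "z \<in> X i" if "i \<in> J" for i
      using that J(1) z by (auto simp: I_def X_def)
    with J(4) show False by blast
  qed
  define T where "T = {s. Some s \<in> J}"
  have J_eq: "J = insert None (Some ` T)"
  proof -
    have "i \<in> insert None (Some ` T)" if "i \<in> J" for i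
      using that by (cases i) (auto simp: T_def)
    then show ?thesis using \<open>None \<in> J\<close> by (auto simp: T_def)
  qed
  have "T \<subseteq> S" using J(1) by (auto simp: T_def I_def)
  moreover have "card T \<le> d"
  proof -
    have "finite T" using \<open>T \<subseteq> S\<close> \<open>finite S\<close> finite_subset by blast
    then have "card J = card T + 1" by (simp add: J_eq card_image)
    then show ?thesis using J(3) by simp
  qed
  moreover have "v \<le> f y" if "y \<in> D" "\<forall>s\<in>T. y \<in> F s" for y
  proof (rule ccontr)
    assume "\<not> v \<le> f y"
    then have "y \<in> (\<Inter>i\<in>J. X i)" using that by (auto simp: J_eq X_def G_def)
    with J(4) show False by blast
  qed
  ultimately show ?thesis by blast
qed

lemma finite_dual_vertices: "finite (dual_vertices C b)"
proof -
  have "dual_polyhedron C b =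
      {z. transpose C *v z = b} \<inter> \<Inter> (range (\<lambda>i. {z. axis i 1 \<bullet> z \<ge> 0}))"
    by (auto simp: dual_polyhedron_def less_eq_vec_def inner_axis')
  moreover have "affine {z. transpose C *v z = b}"
  proof -
    have "transpose C *v (u *\<^sub>R x + v *\<^sub>R y) = b"
      if "transpose C *v x = b" "transpose C *v y = b" "u + v = 1" for x y u v
    proof -
      have "transpose C *v (u *\<^sub>R x + v *\<^sub>R y) = (u + v) *\<^sub>R b"
        using that(1,2)
        by (simp only: matrix_vector_right_distrib matrix_vector_mult_scaleR scaleR_add_left)
      then show ?thesis using that by simp
    qed
    then show ?thesis by (auto simp: affine_def simp del: transpose_matrix_vector)
  qed
  moreover have "polyhedron (\<Inter> (range (\<lambda>i. {z :: real ^ _. axis i 1 \<bullet> z \<ge> 0})))"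
    by (rule polyhedron_Inter) (auto simp: polyhedron_halfspace_ge)
  ultimately have "polyhedron (dual_polyhedron C b)"
    by (metis affine_imp_polyhedron polyhedron_Int)
  then show ?thesis
    unfolding dual_vertices_def by (rule finite_polyhedron_extreme_points)
qed

theorem theorem1:
  fixes \<Xi> :: "(real ^ 'xi) set"
    and C :: "real ^ 'n2 ^ 'm" and b :: "real ^ 'n2"
    and B :: "real ^ 'n1 ^ 'm" and W :: "real ^ 'xi ^ 'm" and w :: "real ^ 'm"
    and A :: "real ^ 'n1 ^ 'k" and a :: "real ^ 'k" and c :: "real ^ 'n1"
    and R :: "(real ^ 'm) set"
    and \<Theta> :: "(real ^ 'th) set"
    and \<phi>0 :: "real ^ 'th \<Rightarrow> real"
    and L :: nat and \<phi> :: "nat \<Rightarrow> real ^ 'th \<Rightarrow> real ^ 'xi \<Rightarrow> real"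
    and D :: "((real ^ 'n1) \<times> (real ^ 'th)) set"
    and p :: nat
  assumes "compact \<Xi>"
    and "CARD('m) \<ge> CARD('n2)"
    and "dual_polyhedron C b \<noteq> {}"
    and "lists_extreme_rays R (dual_recession_cone C)"
    and D: "D = first_stage W w B A a \<Xi> R \<times> \<Theta>"
    and "D \<noteq> {}" and "convex D" and "aff_dim D = int p"
    and "convex_on D (objective c \<phi>0)"
    and finite_value:
      "\<bar>opt_value (objective c \<phi>0) (master_feasible W w B \<Xi> L \<phi> D (dual_vertices C b))\<bar> \<noteq> \<infinity>"
    and attained:
      "\<exists>z\<in>master_feasible W w B \<Xi> L \<phi> D (dual_vertices C b).
         ereal (objective c \<phi>0 z) =
           opt_value (objective c \<phi>0) (master_feasible W w B \<Xi> L \<phi> D (dual_vertices C b))"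
    and "\<forall>s\<in>dual_vertices C b. \<forall>l\<in>{1..L}. convex (cut_set W w B \<Xi> \<phi> D s l)"
  shows "\<exists>S_obj. S_obj \<subseteq> dual_vertices C b \<and> finite S_obj \<and> card S_obj \<le> p \<and>
           opt_value (objective c \<phi>0) (master_feasible W w B \<Xi> L \<phi> D S_obj) =
           opt_value (objective c \<phi>0) (master_feasible W w B \<Xi> L \<phi> D (dual_vertices C b))"
proof -
  let ?S = "dual_vertices C b" and ?f = "objective c \<phi>0"
  let ?M = "master_feasible W w B \<Xi> L \<phi> D"
  \<comment> \<open>Intersecting with \<open>D\<close> matters for \<open>L = 0\<close>, where there are no cuts.\<close>
  define F where "F s = D \<inter> (\<Inter>l\<in>{1..L}. cut_set W w B \<Xi> \<phi> D s l)" for s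
  have M_eq: "?M T = {y \<in> D. \<forall>s\<in>T. y \<in> F s}" for T
    by (auto simp: master_feasible_def cut_set_def F_def)
  obtain z where z: "z \<in> ?M ?S" and z_opt: "ereal (?f z) = opt_value ?f (?M ?S)"
    using attained by blast
  have "\<exists>T\<subseteq>?S. card T \<le> p \<and> (\<forall>y\<in>D. (\<forall>s\<in>T. y \<in> F s) \<longrightarrow> ?f z \<le> ?f y)"
  proof (rule convex_program_few_constraints)
    show "convex (F s)" if "s \<in> ?S" for s
      unfolding F_def using that assms by (intro convex_Int convex_INT) auto
    show "?f z \<le> ?f y" if "y \<in> D" "\<And>s. s \<in> ?S \<Longrightarrow> y \<in> F s" for y
    proof -
      have "y \<in> ?M ?S" using that by (simp add: M_eq)
      then have "opt_value ?f (?M ?S) \<le> ereal (?f y)"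
        unfolding opt_value_def by (rule INF_lower)
      then show ?thesis by (simp flip: z_opt)
    qed
    show "z \<in> D" and "\<And>s. s \<in> ?S \<Longrightarrow> z \<in> F s"
      using z by (simp_all add: M_eq)
  qed (use assms finite_dual_vertices in \<open>auto simp: F_def\<close>)
  then obtain T where T: "T \<subseteq> ?S" "card T \<le> p"
    and bound: "\<And>y. y \<in> ?M T \<Longrightarrow> ?f z \<le> ?f y"
    by (auto simp: M_eq)
  have "opt_value ?f (?M T) = opt_value ?f (?M ?S)"
  proof (rule antisym)
    show "opt_value ?f (?M T) \<le> opt_value ?f (?M ?S)"
      unfolding opt_value_def using T(1) by (intro INF_superset_mono) (auto simp: M_eq)
    show "opt_value ?f (?M ?S) \<le> opt_value ?f (?M T)"
      unfolding z_opt[symmetric]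
      unfolding opt_value_def using bound by (intro INF_greatest) simp
  qed
  then show ?thesis
    using T finite_subset[OF T(1) finite_dual_vertices] by blast
qed

end
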